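(* For $n\ge0$ let $S_n=\sum_{j=1}^n(-1)^{\lfloor j\sqrt2\rfloor}$ (so $S_0=0$). For each integer $m\ge0$ let $A_m$ be the smallest index $n\ge0$ such that $S_n=m$, and let $B_m$ be the smallest index $n\ge0$ such that $S_n=-m$. Then the sequences $A_n$ and $B_n$ satisfy, for all $n\ge1$, the recurrences \[A_{n+1}=6A_n-A_{n-1}+2,\quad\text{with } A_0=0,\ A_1=3,\] and \[B_{n+1}=6B_n-B_{n-1}+2,\quad\text{with } B_0=0,\ B_1=1.\]
   Context: Part of the claim is that $A_m$ and $B_m$ are well defined, i.e. every integer value is attained by the walk $S_n$. *)

theory Defs
  imports Complex_Main
begin

text \<open>The floor is nonnegative here, so the conversion to a natural exponent loses nothing.\<close>

definition S :: "nat \<Rightarrow> int" where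
  "S n = (\<Sum>j=1..n. (-1) ^ nat \<lfloor>real j * sqrt 2\<rfloor>)"

text \<open>
  \<open>LEAST\<close> is total: these are the intended first hitting times only if the values
  \<open>m\<close> and \<open>-m\<close> are attained by \<open>S\<close>.
\<close>

definition A :: "nat \<Rightarrow> nat" where
  "A m = (LEAST n. S n = int m)"

definition B :: "nat \<Rightarrow> nat" where
  "B m = (LEAST n. S n = - int m)"

end

theory Submission
  imports Defs
begin

text \<open>
  Write \<open>F n\<close> for \<open>\<lfloor>n \<surd>2\<rfloor>\<close>. As \<open>1/\<surd>2 + 1/(2 + \<surd>2) = 1\<close>, the Beatty sequences
  \<open>F j\<close> and \<open>F j + 2 j\<close> partition the positive integers. The positive integers up to \<open>F n\<close> consist of
  \<open>F j\<close> for \<open>j \<le> n\<close> and \<open>F j + 2 j\<close> for \<open>j \<le> k\<close>, where \<open>k = F n - n\<close>. Since \<open>F j + 2 j\<close> has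
  the parity of \<open>F j\<close>, summing \<open>(-1) ^ v\<close> over all positive \<open>v \<le> F n\<close> gives the renormalization
  \<open>S n + S k = - [F n is odd]\<close> (lemma \<open>S_renormalization\<close>).

  Hence a visit of the walk to \<open>m\<close> at time \<open>n\<close> comes from a visit to \<open>-m\<close> or \<open>-(m + 1)\<close> at the
  smaller time \<open>k\<close>, and a visit to \<open>-(m + 1)\<close> from a visit to \<open>m\<close> or \<open>m + 1\<close>. So each record
  of the walk arises from the preceding record of opposite sign: if that was set at time \<open>x\<close>,
  the new one is set at the least \<open>n\<close> with \<open>F n - n \<ge> x\<close>, provided that \<open>F n\<close> has the right
  parity; only the first step, from \<open>A 0 = 0\<close> to \<open>B 1 = 1\<close>, needs the least positive such \<open>n\<close>.
  In the order \<open>B 0, A 0, B 1, A 1, \<dots>\<close> these times form a single sequence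
  \<open>0, 0, 1, 3, 8, 20, 49, \<dots>\<close>, called \<open>record_time\<close>, and the map from one to the next is
  solved by a quadratic invariant of Pell type. Taking every second term of its linear
  recurrence gives the recurrences for \<open>A\<close> and \<open>B\<close>.
\<close>

section \<open>The Beatty sequence of the square root of two\<close>

definition F :: "nat \<Rightarrow> nat" where
  "F n = nat \<lfloor>real n * sqrt 2\<rfloor>"

lemma F_0 [simp]: "F 0 = 0"
  by (simp add: F_def)

lemma F_bounds: "real (F n) \<le> real n * sqrt 2" "real n * sqrt 2 < real (F n) + 1"
proof -
  have "0 \<le> \<lfloor>real n * sqrt 2\<rfloor>" by simp
  then have "real (F n) = of_int \<lfloor>real n * sqrt 2\<rfloor>" by (simp add: F_def)
  then show "real (F n) \<le> real n * sqrt 2" "real n * sqrt 2 < real (F n) + 1"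
    by linarith+
qed

lemma F_eqI:
  assumes "real v \<le> real n * sqrt 2" "real n * sqrt 2 < real v + 1"
  shows "F n = v"
proof -
  have "\<lfloor>real n * sqrt 2\<rfloor> = int v"
    using assms by (intro floor_unique) auto
  then show ?thesis by (simp add: F_def)
qed

lemma real_le_mult_sqrt2_iff: "real v \<le> real n * sqrt 2 \<longleftrightarrow> v\<^sup>2 \<le> 2 * n\<^sup>2"
proof -
  have "real v \<le> real n * sqrt 2 \<longleftrightarrow> (real v)\<^sup>2 \<le> (real n * sqrt 2)\<^sup>2"
    using abs_le_square_iff[of "real v" "real n * sqrt 2"] by simp
  also have "\<dots> \<longleftrightarrow> real (v\<^sup>2) \<le> real (2 * n\<^sup>2)"
    by (simp add: power_mult_distrib mult.commute)
  finally show ?thesis by (simp only: of_nat_le_iff)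
qed

lemma two_times_square_neq_square:
  fixes x y :: nat
  assumes "x > 0"
  shows "y\<^sup>2 \<noteq> 2 * x\<^sup>2"
  using assms
proof (induction x arbitrary: y rule: less_induct)
  case (less x)
  show ?case
  proof
    assume eq: "y\<^sup>2 = 2 * x\<^sup>2"
    then have "even y" by (metis dvd_triv_left even_power)
    then obtain z where z: "y = 2 * z" by blast
    with eq have eq': "x\<^sup>2 = 2 * z\<^sup>2" by (simp add: power2_eq_square)
    with less.prems have "z > 0" by (cases z) auto
    moreover from this eq' have "z\<^sup>2 < x\<^sup>2" by simp
    then have "z < x" by (rule power_less_imp_less_base) simp
    ultimately show False using less.IH[of z x] eq' by simp
  qed
qed

lemma real_less_mult_sqrt2:
  assumes "n > 0" "real v \<le> real n * sqrt 2"
  shows "real v < real n * sqrt 2"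
proof -
  have "real v \<noteq> real n * sqrt 2"
  proof
    assume "real v = real n * sqrt 2"
    then have "(real v)\<^sup>2 = (real n * sqrt 2)\<^sup>2" by simp
    then have "real (v\<^sup>2) = real (2 * n\<^sup>2)" by (simp add: power_mult_distrib mult.commute)
    then have "v\<^sup>2 = 2 * n\<^sup>2" by (simp only: of_nat_eq_iff)
    with two_times_square_neq_square[OF assms(1)] show False by simp
  qed
  with assms show ?thesis by simp
qed

lemma F_Suc_cases: "F (Suc n) = F n + 1 \<or> F (Suc n) = F n + 2"
proof -
  have s: "1 < sqrt 2" "sqrt 2 < 2"
    using real_sqrt_less_mono[of 1 2] real_sqrt_less_mono[of 2 4] by simp_all
  have e: "real (Suc n) * sqrt 2 = real n * sqrt 2 + sqrt 2" by (simp add: algebra_simps)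
  have "real (F n) < real (F (Suc n))" "real (F (Suc n)) < real (F n) + 3"
    using F_bounds[of n] F_bounds[of "Suc n"] s e by linarith+
  then show ?thesis by linarith
qed

lemma le_F: "n \<le> F n"
proof (induction n)
  case (Suc n)
  then show ?case using F_Suc_cases[of n] by linarith
qed simp

text \<open>
  The Beatty complement: an integer skipped by \<open>F\<close> has the form \<open>F j + 2 j\<close>, and \<open>F n - n\<close>
  of them lie below \<open>F n\<close>. Both bounds come from scaling an inequality for \<open>n \<surd>2\<close> by the
  unit \<open>\<surd>2 + 1\<close>.
\<close>

lemma F_skipped_value:
  assumes "F (Suc n) = F n + 2"
  shows "F (Suc (F n - n)) + 2 * Suc (F n - n) = F n + 1"
proof -
  define k where "k = Suc (F n - n)"
  have k: "real k = real (F n) - real n + 1" by (simp add: k_def le_F)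
  have up: "real (F n) + 2 < (real n + 1) * sqrt 2"
    using real_less_mult_sqrt2[of "Suc n" "F (Suc n)"] F_bounds(1)[of "Suc n"] assms
    by (simp add: algebra_simps)
  have low: "real n * sqrt 2 < real (F n) + 1" by (rule F_bounds)
  have s: "sqrt 2 * sqrt 2 = 2" "sqrt 2 + 1 > 0"
    by (simp_all add: add_pos_pos)
  have "(sqrt 2 + 1) * (real n * sqrt 2) < (sqrt 2 + 1) * (real (F n) + 1)"
    by (rule mult_strict_left_mono[OF low s(2)])
  then have lower: "real (2 * n) < real k * sqrt 2 + real (F n) + 1"
    using s by (simp add: k algebra_simps)
  have "(sqrt 2 + 1) * (real (F n) + 2) < (sqrt 2 + 1) * ((real n + 1) * sqrt 2)"
    by (rule mult_strict_left_mono[OF up s(2)])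
  then have upper: "real k * sqrt 2 + real (F n) < real (2 * n)"
    using s by (simp add: k algebra_simps)
  have "0 \<le> real k * sqrt 2" by simp
  then have "F n < 2 * n" using upper by linarith
  then have "F k = 2 * n - F n - 1"
    using lower upper by (intro F_eqI) (auto simp: of_nat_diff)
  then show ?thesis
    using \<open>F n < 2 * n\<close> le_F[of n] by (simp add: k_def)
qed

section \<open>Renormalization of the walk\<close>

lemma S_0 [simp]: "S 0 = 0"
  by (simp add: S_def)

lemma S_Suc: "S (Suc n) = S n + (-1) ^ F (Suc n)"
  by (simp add: S_def F_def)

text \<open>
  Both sides are the sum of \<open>(-1) ^ v\<close> over \<open>1 \<le> v \<le> F n\<close>. When \<open>F\<close> skips a value, the two
  sums on the left grow by opposite signs.
\<close>

lemma S_renormalization: "S n + S (F n - n) = - of_bool (odd (F n))"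
proof (induction n)
  case (Suc n)
  show ?case
    using F_Suc_cases[of n]
  proof
    assume one: "F (Suc n) = F n + 1"
    then have "F (Suc n) - Suc n = F n - n" by simp
    with Suc one show ?thesis by (cases "even (F n)") (auto simp: S_Suc)
  next
    assume two: "F (Suc n) = F n + 2"
    then have k: "F (Suc n) - Suc n = Suc (F n - n)" using le_F[of n] by simp
    have "even (F (Suc (F n - n))) \<longleftrightarrow> odd (F n)"
      using arg_cong[OF F_skipped_value[OF two], of even] by simp
    with Suc two show ?thesis unfolding k S_Suc by (cases "even (F n)") auto
  qed
qed simp

section \<open>The times of the records\<close>

fun record_time :: "nat \<Rightarrow> nat" where
  "record_time 0 = 0"
| "record_time (Suc 0) = 0"
| "record_time (Suc (Suc i)) = 2 * record_time (Suc i) + record_time i + 1"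

text \<open>
  In terms of \<open>p = 2 x + 1\<close> and \<open>q = y - x\<close>, where \<open>x\<close> and \<open>y\<close> are consecutive terms, this is
  the Pell equation \<open>p\<^sup>2 - 2 q\<^sup>2 = 1\<close> for even \<open>i\<close> and \<open>p\<^sup>2 - 2 q\<^sup>2 = -1\<close> for odd \<open>i\<close>.
\<close>

lemma record_time_Pell:
  "(record_time (Suc i))\<^sup>2 = (record_time i)\<^sup>2
     + 2 * record_time i * record_time (Suc i) + 2 * record_time i + of_bool (odd i)"
proof (induction i)
  case (Suc i)
  define x y where "x = record_time i" and "y = record_time (Suc i)"
  have "y\<^sup>2 = x\<^sup>2 + 2 * x * y + 2 * x + of_bool (odd i)"
    using Suc by (simp add: x_def y_def)
  then have "(2 * y + x + 1)\<^sup>2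
      = y\<^sup>2 + 2 * y * (2 * y + x + 1) + 2 * y + of_bool (odd (Suc i))"
    by (cases "even i") (simp_all add: power2_eq_square algebra_simps)
  then show ?case by (simp add: x_def y_def)
qed simp

lemma even_record_time_add: "even (record_time i + record_time (Suc i)) \<longleftrightarrow> even i"
  by (induction i) auto

lemma F_record_time: "F (record_time (Suc i)) = record_time (Suc i) + record_time i"
proof (rule F_eqI)
  define x y where "x = record_time i" and "y = record_time (Suc i)"
  have pell: "y\<^sup>2 = x\<^sup>2 + 2 * x * y + 2 * x + of_bool (odd i)"
    using record_time_Pell[of i] by (simp add: x_def y_def)
  have "(y + x)\<^sup>2 \<le> 2 * y\<^sup>2"
    using pell by (simp add: power2_eq_square algebra_simps)
  then show "real (record_time (Suc i) + record_time i) \<le> real (record_time (Suc i)) * sqrt 2"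
    unfolding real_le_mult_sqrt2_iff by (simp add: x_def y_def)
  have "y = 0 \<or> \<not> (y + x + 1)\<^sup>2 \<le> 2 * y\<^sup>2"
    using pell by (cases "even i") (auto simp: power2_eq_square algebra_simps)
  then have "\<not> real (y + x + 1) \<le> real y * sqrt 2"
    unfolding real_le_mult_sqrt2_iff by auto
  then show "real (record_time (Suc i)) * sqrt 2
      < real (record_time (Suc i) + record_time i) + 1"
    by (simp add: x_def y_def)
qed

text \<open>
  Minimality of the next record time. If \<open>F n - n \<ge> x\<close>, then \<open>n > 2 x\<close>, and on that range
  \<open>n\<^sup>2 - 2 n x - x\<^sup>2\<close> grows with \<open>n\<close>; the Pell equation makes it too small at \<open>n = y\<close> for it to
  be nonnegative already at \<open>n = y - 1\<close>. The case \<open>x = 0\<close> is a true exception: then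
  \<open>F 0 - 0 \<ge> x\<close>, although the record time following \<open>A 0 = 0\<close> is \<open>B 1 = 1\<close>.
\<close>

lemma F_less_record_time:
  assumes "n < record_time (Suc i)" "record_time i > 0"
  shows "F n < n + record_time i"
proof (rule ccontr)
  define x y where "x = record_time i" and "y = record_time (Suc i)"
  have pell: "int y * int y = int x * int x + 2 * int x * int y + 2 * int x + of_bool (odd i)"
    using arg_cong[OF record_time_Pell[of i], of int] by (simp add: x_def y_def power2_eq_square)
  have "x > 0" "n < y" using assms by (simp_all add: x_def y_def)
  assume "\<not> F n < n + record_time i"
  then have "real (n + x) \<le> real n * sqrt 2" using F_bounds(1)[of n] by (simp add: x_def)
  then have "(n + x)\<^sup>2 \<le> 2 * n\<^sup>2" by (simp only: real_le_mult_sqrt2_iff)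
  then have "int ((n + x)\<^sup>2) \<le> int (2 * n\<^sup>2)" by (simp only: of_nat_le_iff)
  then have sq: "int x * int x \<le> int n * (int n - 2 * int x)"
    by (simp add: power2_eq_square algebra_simps)
  moreover have "0 < int x * int x" using \<open>x > 0\<close> by simp
  ultimately have "0 < int n * (int n - 2 * int x)" by linarith
  then have n: "2 * int x < int n" by (simp add: zero_less_mult_iff)
  have "int n * (int n - 2 * int x) \<le> (int y - 1) * (int y - 1 - 2 * int x)"
    using n \<open>n < y\<close> by (intro mult_mono) auto
  with sq have "int x * int x \<le> (int y - 1) * (int y - 1 - 2 * int x)" by linarith
  then have "2 * int y \<le> 4 * int x + 2"
    using pell by (cases "even i") (auto simp: algebra_simps)
  with n \<open>n < y\<close> show False by linarith
qed

section \<open>First hitting times\<close>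

lemma S_record_time_Suc:
  "S (record_time (Suc i)) = - S (record_time i) - of_bool (odd i)"
  using S_renormalization[of "record_time (Suc i)"] even_record_time_add[of i]
  by (cases "even i") (simp_all add: F_record_time add.commute)

text \<open>
  The strict bounds before a record time are inherited from those before the preceding record:
  renormalization sends the earlier times, apart from \<open>n = 0\<close> at the start of the walk, to times
  before that preceding record. The parity correction is what lets the records grow: between records
  it acts only on the way from \<open>m\<close> to \<open>-(m + 1)\<close>.
\<close>

lemma record_values:
  "S (record_time (2 * m)) = - int m \<and> (\<forall>n < record_time (2 * m). S n > - int m) \<and>
   S (record_time (Suc (2 * m))) = int m \<and> (\<forall>n < record_time (Suc (2 * m)). S n < int m)"
proof (induction m)
  case (Suc m)
  define i where "i = Suc (2 * m)"
  have i: "2 * Suc m = Suc i" by (simp add: i_def)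
  have top: "S (record_time i) = int m" "\<And>n. n < record_time i \<Longrightarrow> S n < int m"
    using Suc by (simp_all add: i_def)
  have neg: "S (record_time (Suc i)) = - int (Suc m)"
    by (subst S_record_time_Suc) (simp add: top(1), simp add: i_def)
  have before_neg: "S n > - int (Suc m)" if n: "n < record_time (Suc i)" for n
  proof (cases "record_time i = 0")
    case True
    \<comment> \<open>The start of the walk is the record at the value 0, so \<open>m = 0\<close> and \<open>n = 0\<close> here.\<close>
    with n have "n = 0"
      using record_time_Pell[of i] by (auto simp: i_def)
    then show ?thesis by simp
  next
    case False
    then have "F n - n < record_time i"
      using F_less_record_time[OF n] by simp
    then have "S (F n - n) < int m" by (rule top)
    then show ?thesis
      using S_renormalization[of n] by (cases "even (F n)") auto
  qed
  have pos: "S (record_time (Suc (Suc i))) = int (Suc m)"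
    by (subst S_record_time_Suc) (simp add: neg del: record_time.simps, simp add: i_def)
  have before_pos: "S n < int (Suc m)" if n: "n < record_time (Suc (Suc i))" for n
  proof -
    have "record_time (Suc i) > 0" by (simp add: i_def)
    then have "F n - n < record_time (Suc i)"
      using F_less_record_time[OF n] by simp
    then have "S (F n - n) > - int (Suc m)" by (rule before_neg)
    then show ?thesis
      using S_renormalization[of n] by (cases "even (F n)") auto
  qed
  show ?case unfolding i using neg before_neg pos before_pos by blast
qed simp

lemma A_eq_record_time: "A m = record_time (Suc (2 * m))"
  unfolding A_def using record_values[of m]
  by (intro Least_equality) (auto simp: not_less[symmetric])

lemma B_eq_record_time: "B m = record_time (2 * m)"
  unfolding B_def using record_values[of m]
  by (intro Least_equality) (auto simp: not_less[symmetric])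

lemma record_time_recurrence:
  "int (record_time (i + 4)) = 6 * int (record_time (i + 2)) - int (record_time i) + 2"
  by (simp add: numeral_eq_Suc)

theorem corollary4:
  shows "(\<forall>k::int. \<exists>n::nat. S n = k) \<and>
    A 0 = 0 \<and> A 1 = 3 \<and>
    (\<forall>n::nat. n \<ge> 1 \<longrightarrow> int (A (n + 1)) = 6 * int (A n) - int (A (n - 1)) + 2) \<and>
    B 0 = 0 \<and> B 1 = 1 \<and>
    (\<forall>n::nat. n \<ge> 1 \<longrightarrow> int (B (n + 1)) = 6 * int (B n) - int (B (n - 1)) + 2)"
proof (intro conjI allI impI)
  fix k :: int
  show "\<exists>n. S n = k"
  proof (cases "k \<ge> 0")
    case True
    then have "S (record_time (Suc (2 * nat k))) = k" using record_values[of "nat k"] by simp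
    then show ?thesis by blast
  next
    case False
    then have "S (record_time (2 * nat (- k))) = k" using record_values[of "nat (- k)"] by simp
    then show ?thesis by blast
  qed
next
  show "A 0 = 0" "A 1 = 3" "B 0 = 0" "B 1 = 1"
    by (simp_all add: A_eq_record_time B_eq_record_time numeral_eq_Suc)
next
  fix n :: nat
  assume "n \<ge> 1"
  then obtain m where n: "n = Suc m" by (cases n) auto
  show "int (A (n + 1)) = 6 * int (A n) - int (A (n - 1)) + 2"
    using record_time_recurrence[of "Suc (2 * m)"]
    by (simp add: n A_eq_record_time numeral_eq_Suc)
  show "int (B (n + 1)) = 6 * int (B n) - int (B (n - 1)) + 2"
    using record_time_recurrence[of "2 * m"]
    by (simp add: n B_eq_record_time numeral_eq_Suc)
qed

end
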